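(* Let $d\ge1$ be an integer. As $c\to\infty$, $$J^\star(c,\alpha_d)\sim(1+\alpha_d c)^{-1},$$ i.e. $(1+\alpha_d c)\,J^\star(c,\alpha_d)\to1$.
   Context: For $c>0$ and $\alpha\in[0,1]$, $J^\star(c,\alpha)$ is the smallest nonnegative root of the function $x(t)$ that solves $$x(t)=1-t-\int_0^t\left(\frac{x(s)\,\alpha c}{1-(\alpha c+1)s}+(1-\alpha)c\,x(s)\right)ds,\qquad 0\le t\le 1/(1+\alpha c),$$ with $x$ continuous. Furthermore $$\alpha_d=d\int_0^1x^{d-1}I_{1-\frac{x^2}{4}}\Bigl(\frac{d+1}{2},\frac12\Bigr)dx,\qquad I_z(a,b)=\frac{\int_0^zy^{a-1}(1-y)^{b-1}dy}{\int_0^1y^{a-1}(1-y)^{b-1}dy},$$ $I_z(a,b)$ being the normalized incomplete beta integral. *)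

theory Defs
  imports "HOL-Analysis.Analysis" "HOL-Library.Landau_Symbols"
begin

(* For t = 1/(1 + alpha*c) the integrand is singular at s = t when alpha > 0, and the integral is
   improper.  The gauge integral does not depend on the value of the quotient at that point. *)
definition solves_integral_eq :: "real \<Rightarrow> real \<Rightarrow> (real \<Rightarrow> real) \<Rightarrow> bool" where
  "solves_integral_eq c \<alpha> x \<longleftrightarrow>
     continuous_on {0..1 / (1 + \<alpha> * c)} x \<and>
     (\<forall>t\<in>{0..1 / (1 + \<alpha> * c)}.
        (\<lambda>s. x s * \<alpha> * c / (1 - (\<alpha> * c + 1) * s) + (1 - \<alpha>) * c * x s) integrable_on {0..t} \<and>
        x t = 1 - t - integral {0..t}
          (\<lambda>s. x s * \<alpha> * c / (1 - (\<alpha> * c + 1) * s) + (1 - \<alpha>) * c * x s))"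

(* The equation determines x only on {0..1 / (1 + alpha*c)}, so roots are sought there. *)
definition J_star :: "real \<Rightarrow> real \<Rightarrow> real" where
  "J_star c \<alpha> = (THE r. \<exists>x. solves_integral_eq c \<alpha> x \<and>
     r \<in> {0..1 / (1 + \<alpha> * c)} \<and> x r = 0 \<and> (\<forall>t\<in>{0..<r}. x t \<noteq> 0))"

definition inc_beta :: "real \<Rightarrow> real \<Rightarrow> real \<Rightarrow> real" where
  "inc_beta z a b =
     integral {0..z} (\<lambda>y. y powr (a - 1) * (1 - y) powr (b - 1)) /
     integral {0..1} (\<lambda>y. y powr (a - 1) * (1 - y) powr (b - 1))"

definition alpha_dim :: "nat \<Rightarrow> real" where
  "alpha_dim d = real d *
     integral {0..1} (\<lambda>x. x ^ (d - 1) * inc_beta (1 - x\<^sup>2 / 4) ((real d + 1) / 2) (1 / 2))"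

end

theory Submission
  imports Defs
begin

text \<open>
  Write \<open>w t = 1 - (1 + \<alpha>c) t\<close>, so that \<open>w\<close> falls from \<open>1\<close> to \<open>0\<close> on \<open>[0, T]\<close> with
  \<open>T = 1 / (1 + \<alpha>c)\<close>.  If \<open>r\<close> is the smallest root, then \<open>(1 + \<alpha>c) r = 1 - w r\<close>, and the claim
  is that \<open>w r\<close> tends to \<open>0\<close>.

  Differentiation turns the integral equation into the linear initial value problem
  \<open>x' = - 1 - x (\<alpha>c / w + k)\<close>, \<open>x 0 = 1\<close>, with \<open>k = (1 - \<alpha>) c\<close>.  Its integrating factor is
  \<open>\<mu> t = w t powr (-p) * exp (k t)\<close> with \<open>p = \<alpha>c / (1 + \<alpha>c)\<close>, which gives the unique solution
  \<open>(1 - F t) / \<mu> t\<close>, where \<open>F\<close> is the primitive of \<open>\<mu>\<close> vanishing at \<open>0\<close> (lemmas \<open>sol_solves\<close>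
  and \<open>solution_unique\<close>).  Since \<open>1 / \<mu>\<close> vanishes at \<open>T\<close>, so does the solution; hence roots exist,
  and a root before \<open>T\<close> is a point where \<open>F\<close> equals \<open>1\<close>.

  Now \<open>k s\<close> is at most \<open>M = \<bar>1 - \<alpha>\<bar> / \<alpha>\<close> on \<open>[0, T]\<close>, a bound free of \<open>c\<close>, and \<open>w powr (-p)\<close>
  integrates to \<open>1 - w powr T\<close>.  So \<open>F t \<le> exp M * (1 - w t powr T)\<close>, and \<open>F r = 1\<close> forces
  \<open>w r \<le> (1 - exp (-M)) powr (1 + \<alpha>c)\<close>, which decays exponentially in \<open>c\<close> for every fixed
  \<open>\<alpha> > 0\<close> (lemmas \<open>w_J_star_le\<close> and \<open>J_star_asymp_equiv\<close>).  What remains is that the constant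
  of dimension \<open>d\<close> is positive; this holds because in its integrand the argument of the incomplete
  beta function never drops below \<open>3/4\<close> (lemma \<open>alpha_dim_pos\<close>).
\<close>

section \<open>Solution of the integral equation\<close>

locale linear_integral_equation =
  fixes c \<alpha> :: real
  assumes c_pos: "c > 0" and \<alpha>_pos: "\<alpha> > 0"
begin

definition T :: real where "T = 1 / (1 + \<alpha> * c)"

definition p :: real where "p = \<alpha> * c / (1 + \<alpha> * c)"

definition k :: real where "k = (1 - \<alpha>) * c"

definition w :: "real \<Rightarrow> real" where "w t = 1 - (\<alpha> * c + 1) * t"

text \<open>The integrating factor: its logarithmic derivative before \<open>T\<close> is \<open>\<alpha> * c / w + k\<close>.\<close>

definition \<mu> :: "real \<Rightarrow> real" where "\<mu> t = w t powr (- p) * exp (k * t)"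

definition F :: "real \<Rightarrow> real" where "F t = integral {0..t} \<mu>"

text \<open>The solution is \<open>(1 - F t) / \<mu> t\<close>; writing out the reciprocal of \<open>\<mu>\<close> makes continuity at \<open>T\<close>,
  near which \<open>\<mu>\<close> blows up, visible.\<close>

definition sol :: "real \<Rightarrow> real" where "sol t = w t powr p * exp (- k * t) * (1 - F t)"

abbreviation integrand :: "(real \<Rightarrow> real) \<Rightarrow> real \<Rightarrow> real" where
  "integrand x s \<equiv> x s * \<alpha> * c / (1 - (\<alpha> * c + 1) * s) + (1 - \<alpha>) * c * x s"

lemma ac_pos: "\<alpha> * c > 0"
  using c_pos \<alpha>_pos by simp

lemma T_pos: "T > 0" and p_pos: "p > 0" and one_minus_p: "1 - p = T"
  and T_mult: "T * (\<alpha> * c + 1) = 1"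
  using ac_pos by (auto simp: T_def p_def field_simps)

lemma w_pos: "t < T \<Longrightarrow> w t > 0"
  using ac_pos by (simp add: T_def w_def field_simps)

lemma w_T: "w T = 0"
  using T_mult by (simp add: w_def mult.commute)

lemma w_0: "w 0 = 1"
  by (simp add: w_def)

lemma w_nonneg: "t \<le> T \<Longrightarrow> w t \<ge> 0"
  using w_pos[of t] w_T by (cases "t = T") auto

lemma integrand_eq: "integrand x s = x s * (\<alpha> * c / w s + k)"
  by (simp add: w_def k_def algebra_simps)

lemma continuous_w [continuous_intros]: "continuous_on S w"
  unfolding w_def by (intro continuous_intros)

lemma w_deriv: "(w has_real_derivative - (\<alpha> * c + 1)) (at t)"
  unfolding w_def by (auto intro!: derivative_eq_intros)

text \<open>The derivative of \<open>- (w powr T)\<close> is \<open>w powr (-p)\<close> because \<open>T = 1 - p\<close> cancels the slope of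
  \<open>w\<close>.  The singularity at \<open>T\<close> is integrable since this antiderivative is still continuous there.\<close>

lemma w_powr_has_integral:
  assumes "0 \<le> t" "t \<le> T"
  shows "((\<lambda>s. w s powr (- p)) has_integral (1 - w t powr T)) {0..t}"
proof -
  have "((\<lambda>s. w s powr (- p)) has_integral (- (w t powr T) - - (w 0 powr T))) {0..t}"
  proof (rule fundamental_theorem_of_calculus_interior[OF assms(1)])
    show "continuous_on {0..t} (\<lambda>s. - (w s powr T))"
      using T_pos assms by (intro continuous_intros continuous_on_powr') (auto intro: w_nonneg)
    fix s assume "s \<in> {0<..<t}"
    then have ws: "w s > 0" using assms by (auto intro: w_pos)
    have "((\<lambda>s. - (w s powr T)) has_real_derivative
            - (T * w s powr (T - 1) * (- (\<alpha> * c + 1)))) (at s)"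
      using ws by (auto intro!: derivative_eq_intros w_deriv)
    moreover have "- (T * w s powr (T - 1) * (- (\<alpha> * c + 1)))
        = (T * (\<alpha> * c + 1)) * w s powr (T - 1)"
      by (simp add: algebra_simps)
    moreover have "T - 1 = - p" using one_minus_p by simp
    ultimately show "((\<lambda>s. - (w s powr T)) has_vector_derivative w s powr (- p)) (at s)"
      by (simp add: T_mult has_real_derivative_iff_has_vector_derivative)
  qed
  then show ?thesis by (simp add: w_0)
qed

lemma \<mu>_integrable: "\<mu> integrable_on {0..T}"
proof -
  have 1: "(\<lambda>s. w s powr (- p)) absolutely_integrable_on {0..T}"
    using w_powr_has_integral[of T] T_pos
    by (intro nonnegative_absolutely_integrable_1) (auto simp: integrable_on_def)
  have "(\<lambda>s. exp (k * s) * w s powr (- p)) absolutely_integrable_on {0..T}"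
  proof (rule absolutely_integrable_bounded_measurable_product_real[OF _ _ _ 1])
    show "(\<lambda>s. exp (k * s)) \<in> borel_measurable (lebesgue_on {0..T})"
      by (intro continuous_imp_measurable_on_sets_lebesgue continuous_intros) auto
    show "bounded ((\<lambda>s. exp (k * s)) ` {0..T})"
      by (intro compact_imp_bounded compact_continuous_image continuous_intros) auto
  qed auto
  then show ?thesis
    unfolding \<mu>_def by (simp add: absolutely_integrable_on_def mult.commute)
qed

lemma \<mu>_integrable_sub: "t \<le> T \<Longrightarrow> \<mu> integrable_on {0..t}"
  by (rule integrable_on_subinterval[OF \<mu>_integrable]) auto

lemma F_continuous: "continuous_on {0..T} F"
  unfolding F_def by (rule indefinite_integral_continuous_1[OF \<mu>_integrable])

lemma F_0: "F 0 = 0"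
  by (simp add: F_def)

lemma F_deriv:
  assumes "0 < t" "t < T"
  shows "(F has_real_derivative \<mu> t) (at t)"
proof -
  \<comment> \<open>\<open>(t + T) / 2\<close> lies beyond \<open>t\<close> but still before the singularity at \<open>T\<close>\<close>
  have w: "w s > 0" if "s \<in> {0..(t+T)/2}" for s
    using that assms by (intro w_pos) auto
  have "continuous_on {0..(t+T)/2} \<mu>"
    unfolding \<mu>_def by (intro continuous_intros continuous_on_powr) (auto dest: w)
  then have "(F has_real_derivative \<mu> t) (at t within {0..(t+T)/2})"
    unfolding F_def using assms by (intro integral_has_real_derivative) auto
  then have "(F has_real_derivative \<mu> t) (at t within {0<..<(t+T)/2})"
    by (rule DERIV_subset) auto
  then show ?thesis using assms by (subst (asm) at_within_open) auto
qed

lemma sol_continuous: "continuous_on {0..T} sol"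
  unfolding sol_def using p_pos
  by (intro continuous_intros continuous_on_powr' F_continuous) (auto intro: w_nonneg)

lemma sol_T: "sol T = 0"
  by (simp add: sol_def w_T)

lemma \<mu>_deriv:
  assumes "t < T"
  shows "(\<mu> has_real_derivative \<mu> t * (\<alpha> * c / w t + k)) (at t)"
proof -
  have ws: "w t > 0" using w_pos[OF assms] .
  have deriv: "(\<mu> has_real_derivative (- p * w t powr (- p - 1) * (- (\<alpha> * c + 1))) * exp (k * t)
          + exp (k * t) * k * w t powr (- p)) (at t)"
    unfolding \<mu>_def using ws by (auto intro!: derivative_eq_intros w_deriv)
  have "p * (\<alpha> * c + 1) = \<alpha> * c" using ac_pos by (simp add: p_def field_simps)
  then have "- p * w t powr (- p - 1) * (- (\<alpha> * c + 1)) = \<alpha> * c * w t powr (- p - 1)"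
    by (metis (no_types, opaque_lifting) minus_mult_minus mult.assoc mult.commute)
  moreover have "w t powr (- p - 1) = w t powr (- p) / w t"
    using ws by (simp add: powr_diff)
  ultimately have "(- p * w t powr (- p - 1) * (- (\<alpha> * c + 1))) * exp (k * t)
      + exp (k * t) * k * w t powr (- p) = \<mu> t * (\<alpha> * c / w t + k)"
    by (simp only: \<mu>_def) (simp add: algebra_simps)
  with deriv show ?thesis by (simp only:)
qed

lemma \<mu>_pos: "t < T \<Longrightarrow> \<mu> t > 0"
  using w_pos[of t] by (simp add: \<mu>_def)

lemma sol_eq: "t < T \<Longrightarrow> sol t = (1 - F t) / \<mu> t"
  using w_pos[of t] by (simp add: sol_def \<mu>_def powr_minus exp_minus field_simps)

lemma sol_deriv:
  assumes "0 < t" "t < T"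
  shows "(sol has_real_derivative - 1 - integrand sol t) (at t)"
proof -
  have "((\<lambda>t. (1 - F t) / \<mu> t) has_real_derivative
      (- \<mu> t * \<mu> t - (1 - F t) * (\<mu> t * (\<alpha> * c / w t + k))) / (\<mu> t * \<mu> t)) (at t)"
    using \<mu>_pos[OF assms(2)]
    by (auto intro!: derivative_eq_intros F_deriv[OF assms] \<mu>_deriv[OF assms(2)])
  moreover have "(- m * m - z * (m * q)) / (m * m) = - 1 - z / m * q" if "m > 0" for m z q :: real
    using that by (simp add: diff_divide_distrib)
  then have "(- \<mu> t * \<mu> t - (1 - F t) * (\<mu> t * (\<alpha> * c / w t + k))) / (\<mu> t * \<mu> t)
      = - 1 - integrand sol t"
    unfolding integrand_eq unfolding sol_eq[OF assms(2)] using \<mu>_pos[OF assms(2)] by blast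
  ultimately have "((\<lambda>t. (1 - F t) / \<mu> t) has_real_derivative - 1 - integrand sol t) (at t)"
    by simp
  then show ?thesis
    by (rule has_field_derivative_transform_within_open[of _ _ _ "{..<T}"])
       (use assms sol_eq in auto)
qed

text \<open>The improper case \<open>t = T\<close> needs no limit argument: the fundamental theorem for the gauge
  integral asks for a derivative only in the open interval and for continuity up to the endpoint,
  and so yields integrability together with the value.\<close>

lemma sol_solves: "solves_integral_eq c \<alpha> sol"
  unfolding solves_integral_eq_def T_def[symmetric]
proof (intro conjI ballI)
  show "continuous_on {0..T} sol" by (rule sol_continuous)
  fix t assume t: "t \<in> {0..T}"
  have "(integrand sol has_integral ((- t - sol t) - (- 0 - sol 0))) {0..t}"
  proof (rule fundamental_theorem_of_calculus_interior)
    show "0 \<le> t" using t by auto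
    show "continuous_on {0..t} (\<lambda>t. - t - sol t)"
      by (intro continuous_intros continuous_on_subset[OF sol_continuous]) (use t in auto)
    fix s assume "s \<in> {0<..<t}"
    then have "0 < s" "s < T" using t by auto
    then have "((\<lambda>t. - t - sol t) has_real_derivative - 1 - (- 1 - integrand sol s)) (at s)"
      by (auto intro!: derivative_eq_intros sol_deriv simp del: right_minus_eq)
    then show "((\<lambda>t. - t - sol t) has_vector_derivative integrand sol s) (at s)"
      by (simp add: has_real_derivative_iff_has_vector_derivative)
  qed
  moreover have "sol 0 = 1" by (simp add: sol_def w_0 F_0)
  ultimately have "(integrand sol has_integral (1 - t - sol t)) {0..t}"
    by (simp add: algebra_simps)
  then show "integrand sol integrable_on {0..t}"
    and "sol t = 1 - t - integral {0..t} (integrand sol)"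
    by (auto simp: integrable_on_def dest: integral_unique)
qed

text \<open>For any solution \<open>x\<close> the quantity \<open>x * \<mu> + F\<close> has derivative zero and is therefore \<open>1\<close>, which
  is the formula for \<open>sol\<close> before \<open>T\<close>; at \<open>T\<close> the two functions agree by continuity.\<close>

lemma solution_unique:
  assumes "solves_integral_eq c \<alpha> x" "t \<in> {0..T}"
  shows "x t = sol t"
proof -
  have cont: "continuous_on {0..T} x"
    and eq: "\<And>t. t \<in> {0..T} \<Longrightarrow> x t = 1 - t - integral {0..t} (integrand x)"
    using assms(1) by (auto simp: solves_integral_eq_def T_def)
  have x_deriv: "(x has_real_derivative - 1 - integrand x t) (at t)" if t: "0 < t" "t < T" for t
  proof -
    let ?u = "(t + T) / 2"
    have w: "w s > 0" if "s \<in> {0..?u}" for s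
      using that t by (intro w_pos) auto
    have "continuous_on {0..?u} (\<lambda>s. x s * (\<alpha> * c / w s + k))"
      by (intro continuous_intros continuous_on_subset[OF cont]) (use t in \<open>auto dest: w\<close>)
    then have "continuous_on {0..?u} (integrand x)"
      by (simp only: integrand_eq)
    then have "((\<lambda>t. integral {0..t} (integrand x)) has_real_derivative integrand x t)
        (at t within {0..?u})"
      using t by (intro integral_has_real_derivative) auto
    then have "((\<lambda>t. integral {0..t} (integrand x)) has_real_derivative integrand x t)
        (at t within {0<..<?u})"
      by (rule DERIV_subset) auto
    then have "((\<lambda>t. integral {0..t} (integrand x)) has_real_derivative integrand x t) (at t)"
      using t by (subst (asm) at_within_open) auto
    then have "((\<lambda>t. 1 - t - integral {0..t} (integrand x)) has_real_derivative
        (- 1 - integrand x t)) (at t)"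
      by (auto intro!: derivative_eq_intros)
    then show ?thesis
      by (rule has_field_derivative_transform_within_open[of _ _ _ "{0<..<T}"])
         (use t eq in auto)
  qed
  have below: "x t = sol t" if t: "t \<in> {0..<T}" for t
  proof -
    let ?y = "\<lambda>t. x t * \<mu> t + F t"
    have "?y t = ?y 0"
    proof (cases "t = 0")
      case False
      show ?thesis
      proof (rule DERIV_isconst_end[of 0 t ?y])
        show "0 < t" using False t by auto
        have "w s > 0" if "s \<in> {0..t}" for s using that t by (intro w_pos) auto
        then have "continuous_on {0..t} \<mu>"
          unfolding \<mu>_def by (intro continuous_intros continuous_on_powr) force+
        then show "continuous_on {0..t} ?y"
          by (intro continuous_intros continuous_on_subset[OF cont]
                continuous_on_subset[OF F_continuous]) (use t in auto)
        fix s assume "0 < s" "s < t"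
        then have s: "0 < s" "s < T" using t by auto
        have "(?y has_real_derivative ((- 1 - integrand x s) * \<mu> s
            + \<mu> s * (\<alpha> * c / w s + k) * x s + \<mu> s)) (at s)"
          using s by (intro derivative_intros DERIV_mult x_deriv \<mu>_deriv F_deriv) auto
        then show "(?y has_real_derivative 0) (at s)"
          unfolding integrand_eq by (simp add: algebra_simps)
      qed
    qed auto
    also have "x 0 = 1" using eq[of 0] T_pos by simp
    then have "?y 0 = 1" by (simp add: \<mu>_def w_0 F_0)
    finally show ?thesis
      using t \<mu>_pos[of t] by (simp add: sol_eq field_simps)
  qed
  have "x t - sol t = 0"
    \<comment> \<open>\<open>[0, T]\<close> is the closure of \<open>[0, T)\<close>\<close>
  proof (rule continuous_constant_on_closure[of "{0..<T}" "\<lambda>t. x t - sol t"])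
    show "continuous_on (closure {0..<T}) (\<lambda>t. x t - sol t)"
      using T_pos by (auto intro!: continuous_intros cont sol_continuous)
  qed (use assms(2) T_pos below in auto)
  then show ?thesis by simp
qed

section \<open>The smallest root and its asymptotics\<close>

text \<open>The definite description defining \<open>J_star\<close> denotes: all solutions agree with \<open>sol\<close> on \<open>[0, T]\<close>,
  whose zero set there is compact and contains \<open>T\<close>, so it has a least element.\<close>

lemma J_star_root: "J_star c \<alpha> \<in> {0..T}" "sol (J_star c \<alpha>) = 0"
proof -
  let ?first = "\<lambda>r x. r \<in> {0..T} \<and> x r = 0 \<and> (\<forall>t\<in>{0..<r}. x t \<noteq> (0::real))"
  let ?Z = "{t \<in> {0..T}. sol t = 0}"
  have "closed ?Z"
    by (intro continuous_closed_preimage_constant sol_continuous) auto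
  then have "compact ?Z"
    by (simp add: compact_eq_bounded_closed)
       (rule bounded_subset[of "{0..T}"], auto)
  moreover have "?Z \<noteq> {}" using sol_T T_pos by auto
  ultimately obtain r where r: "r \<in> ?Z" "\<forall>t\<in>?Z. r \<le> t"
    using compact_attains_inf by blast
  have fr: "?first r sol" using r by force
  have J: "J_star c \<alpha> = (THE r. \<exists>x. solves_integral_eq c \<alpha> x \<and> ?first r x)"
    by (simp add: J_star_def T_def)
  have "J_star c \<alpha> = r"
    unfolding J
  proof (rule the_equality)
    show "\<exists>x. solves_integral_eq c \<alpha> x \<and> ?first r x" using fr sol_solves by blast
    fix q assume "\<exists>x. solves_integral_eq c \<alpha> x \<and> ?first q x"
    then obtain x where x: "solves_integral_eq c \<alpha> x" "?first q x" by blast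
    then have "?first q sol"
      using solution_unique[OF x(1)] by auto
    with fr show "q = r" by (metis atLeastAtMost_iff atLeastLessThan_iff linorder_cases)
  qed
  then show "J_star c \<alpha> \<in> {0..T}" "sol (J_star c \<alpha>) = 0" using fr by auto
qed

text \<open>The exponential factor in \<open>\<mu>\<close> stays bounded uniformly in \<open>c\<close>, because the domain shrinks like
  \<open>1 / (\<alpha> * c)\<close> while the rate \<open>k\<close> grows at most linearly in \<open>c\<close>.\<close>

lemma F_le:
  assumes "t \<in> {0..T}"
  shows "F t \<le> exp (\<bar>1 - \<alpha>\<bar> / \<alpha>) * (1 - w t powr T)"
proof -
  have I: "((\<lambda>s. exp (\<bar>1 - \<alpha>\<bar> / \<alpha>) * w s powr (- p)) has_integral
      exp (\<bar>1 - \<alpha>\<bar> / \<alpha>) * (1 - w t powr T)) {0..t}"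
    using assms by (intro has_integral_mult_right w_powr_has_integral) auto
  have "F t \<le> integral {0..t} (\<lambda>s. exp (\<bar>1 - \<alpha>\<bar> / \<alpha>) * w s powr (- p))"
    unfolding F_def
  proof (rule integral_le)
    fix s assume s: "s \<in> {0..t}"
    have "k * s \<le> \<bar>k\<bar> * T"
      using s assms by (intro mult_mono) auto
    also have "\<dots> = \<bar>1 - \<alpha>\<bar> * (c * T)"
      using c_pos by (simp add: k_def abs_mult)
    also have "\<dots> \<le> \<bar>1 - \<alpha>\<bar> * (1 / \<alpha>)"
    proof (intro mult_left_mono)
      show "c * T \<le> 1 / \<alpha>"
        using \<alpha>_pos ac_pos by (simp add: T_def field_simps)
    qed auto
    finally show "\<mu> s \<le> exp (\<bar>1 - \<alpha>\<bar> / \<alpha>) * w s powr (- p)"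
      by (simp add: \<mu>_def mult.commute mult_right_mono)
  qed (use assms I in \<open>auto intro: \<mu>_integrable_sub has_integral_integrable\<close>)
  then show ?thesis by (simp only: integral_unique[OF I])
qed

text \<open>At a root either \<open>w\<close> vanishes or \<open>F\<close> equals \<open>1\<close>.  In the second case the bound on \<open>F\<close> is
  solved for \<open>w\<close>; the small exponent \<open>T\<close> turns into the large exponent \<open>1 / T\<close>.\<close>

lemma w_J_star_le:
  "w (J_star c \<alpha>) \<le> (1 - exp (- (\<bar>1 - \<alpha>\<bar> / \<alpha>))) powr (1 + \<alpha> * c)"
proof -
  let ?r = "J_star c \<alpha>" and ?E = "exp (\<bar>1 - \<alpha>\<bar> / \<alpha>)"
  have w0: "w ?r \<ge> 0" using J_star_root by (auto intro: w_nonneg)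
  show ?thesis
  proof (cases "w ?r = 0")
    case False
    with w0 have wr: "w ?r > 0" by simp
    then have "F ?r = 1" using J_star_root by (simp add: sol_def)
    then have "1 \<le> ?E * (1 - w ?r powr T)" using F_le[OF J_star_root(1)] by simp
    then have "w ?r powr T \<le> 1 - exp (- (\<bar>1 - \<alpha>\<bar> / \<alpha>))"
      by (simp add: exp_minus field_simps)
    then have "(w ?r powr T) powr (1 + \<alpha> * c)
        \<le> (1 - exp (- (\<bar>1 - \<alpha>\<bar> / \<alpha>))) powr (1 + \<alpha> * c)"
      using ac_pos by (intro powr_mono2) auto
    moreover have "T * (1 + \<alpha> * c) = 1" using T_mult by (simp add: add.commute)
    ultimately show ?thesis using wr by (simp add: powr_powr)
  qed simp
qed

end

text \<open>The quotient of the two sides is \<open>1 - w\<close> at the smallest root.  It lies between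
  \<open>1 - B powr (1 + \<alpha> * c)\<close> and \<open>1\<close>, with a base \<open>B < 1\<close> that depends on \<open>\<alpha>\<close> alone.\<close>

lemma J_star_asymp_equiv:
  fixes \<alpha> :: real
  assumes "\<alpha> > 0"
  shows "(\<lambda>c. J_star c \<alpha>) \<sim>[at_top] (\<lambda>c. inverse (1 + \<alpha> * c))"
proof (rule asymp_equivI')
  define B where "B = 1 - exp (- (\<bar>1 - \<alpha>\<bar> / \<alpha>))"
  have B: "0 \<le> B" "B < 1" using assms by (auto simp: B_def)
  have bounds: "1 - B powr (1 + \<alpha> * c) \<le> J_star c \<alpha> / inverse (1 + \<alpha> * c)
      \<and> J_star c \<alpha> / inverse (1 + \<alpha> * c) \<le> 1" if "c > 0" for c
  proof -
    interpret linear_integral_equation c \<alpha> using that assms by unfold_locales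
    have "J_star c \<alpha> / inverse (1 + \<alpha> * c) = 1 - w (J_star c \<alpha>)"
      by (simp add: w_def divide_inverse algebra_simps)
    moreover have "w (J_star c \<alpha>) \<ge> 0" using J_star_root by (auto intro: w_nonneg)
    ultimately show ?thesis using w_J_star_le by (simp add: B_def)
  qed
  have "((\<lambda>c. B powr (1 + \<alpha> * c)) \<longlongrightarrow> 0) at_top"
  proof (cases "B = 0")
    case False
    with B have "B > 0" by simp
    have "filterlim (\<lambda>c. 1 + \<alpha> * c) at_top at_top"
      using assms by (intro filterlim_tendsto_add_at_top[OF tendsto_const]
        filterlim_tendsto_pos_mult_at_top[OF tendsto_const _ filterlim_ident])
    then have "filterlim (\<lambda>c. (1 + \<alpha> * c) * ln B) at_bot at_top"
      using \<open>B > 0\<close> \<open>B < 1\<close> by (subst mult.commute) (auto intro!: filterlim_tendsto_neg_mult_at_bot)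
    then have "((\<lambda>c. exp ((1 + \<alpha> * c) * ln B)) \<longlongrightarrow> 0) at_top"
      by (rule filterlim_compose[OF exp_at_bot])
    then show ?thesis using False by (simp add: powr_def)
  qed simp
  then have "((\<lambda>c. 1 - B powr (1 + \<alpha> * c)) \<longlongrightarrow> 1 - 0) at_top"
    by (intro tendsto_intros)
  then have lower: "((\<lambda>c. 1 - B powr (1 + \<alpha> * c)) \<longlongrightarrow> 1) at_top" by simp
  show "((\<lambda>c. J_star c \<alpha> / inverse (1 + \<alpha> * c)) \<longlongrightarrow> 1) at_top"
  proof (rule tendsto_sandwich[OF _ _ lower tendsto_const])
    show "\<forall>\<^sub>F c in at_top. 1 - B powr (1 + \<alpha> * c) \<le> J_star c \<alpha> / inverse (1 + \<alpha> * c)"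
      using eventually_gt_at_top[of 0] by eventually_elim (use bounds in blast)
    show "\<forall>\<^sub>F c in at_top. J_star c \<alpha> / inverse (1 + \<alpha> * c) \<le> 1"
      using eventually_gt_at_top[of 0] by eventually_elim (use bounds in blast)
  qed
qed

section \<open>Positivity of the constant\<close>

lemma inc_beta_continuous_mono:
  fixes a b :: real
  assumes "a > 0" "b > 0"
  shows inc_beta_continuous: "continuous_on {0..1} (\<lambda>z. inc_beta z a b)"
    and inc_beta_mono: "\<And>y z. 0 \<le> y \<Longrightarrow> y \<le> z \<Longrightarrow> z \<le> 1 \<Longrightarrow> inc_beta y a b \<le> inc_beta z a b"
proof -
  let ?g = "\<lambda>y. y powr (a - 1) * (1 - y) powr (b - 1)"
  have I: "?g integrable_on {0..1}"
    using has_integral_Beta_real[OF assms] by (auto simp: integrable_on_def)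
  have Bpos: "integral {0..1} ?g > 0"
    using has_integral_Beta_real[OF assms] assms
    by (simp add: integral_unique Beta_def Gamma_real_pos)
  show "continuous_on {0..1} (\<lambda>z. inc_beta z a b)"
    unfolding inc_beta_def using Bpos
    by (intro continuous_intros indefinite_integral_continuous_1 I) auto
  fix y z :: real assume "0 \<le> y" "y \<le> z" "z \<le> 1"
  then show "inc_beta y a b \<le> inc_beta z a b"
    unfolding inc_beta_def using Bpos
    by (intro divide_right_mono integral_subset_le integrable_on_subinterval[OF I]) auto
qed

text \<open>Since \<open>(1 - y) powr (-1/2) \<ge> 1\<close> for \<open>0 \<le> y < 1\<close>, the unnormalized integral is at least that of
  \<open>y powr (a - 1)\<close>, which is known explicitly.\<close>

lemma inc_beta_half_pos:
  fixes a z :: real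
  assumes "a > 0" "0 < z" "z < 1"
  shows "inc_beta z a (1 / 2) > 0"
proof -
  let ?g = "\<lambda>y. y powr (a - 1) * (1 - y) powr (1 / 2 - 1)"
  have I: "(?g has_integral Beta a (1 / 2)) {0..1}"
    using has_integral_Beta_real[of a "1 / 2"] assms by simp
  have J: "((\<lambda>y. y powr (a - 1)) has_integral (z powr (a - 1 + 1) / (a - 1 + 1))) {0..z}"
    using has_integral_powr_from_0[of "a - 1" z] assms by simp
  have "0 < z powr (a - 1 + 1) / (a - 1 + 1)" using assms by simp
  also have "\<dots> = integral {0..z} (\<lambda>y. y powr (a - 1))" using J by (simp add: integral_unique)
  also have "\<dots> \<le> integral {0..z} ?g"
  proof (rule integral_le)
    show "?g integrable_on {0..z}"
      by (rule integrable_on_subinterval[OF has_integral_integrable[OF I]]) (use assms in auto)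
    fix y assume "y \<in> {0..z}"
    then have "1 powr (1 / 2 - 1) \<le> (1 - y) powr (1 / 2 - 1 :: real)"
      using assms by (intro powr_mono2') auto
    then show "y powr (a - 1) \<le> ?g y"
      by (simp add: mult_le_cancel_left1)
  qed (rule has_integral_integrable[OF J])
  finally have "integral {0..z} ?g > 0" .
  moreover have "integral {0..1} ?g > 0"
    using I assms by (simp add: integral_unique Beta_def Gamma_real_pos)
  ultimately show ?thesis by (simp add: inc_beta_def)
qed

text \<open>For \<open>x \<in> [0, 1]\<close> the argument \<open>1 - x\<^sup>2 / 4\<close> is at least \<open>3 / 4\<close>, so monotonicity bounds the
  integrand below by \<open>x ^ (d - 1)\<close> times a positive constant.\<close>

lemma alpha_dim_pos:
  assumes "d \<ge> 1"
  shows "alpha_dim d > 0"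
proof -
  let ?a = "(real d + 1) / 2"
  let ?m = "inc_beta (3 / 4) ?a (1 / 2)"
  let ?h = "\<lambda>x::real. inc_beta (1 - x\<^sup>2 / 4) ?a (1 / 2)"
  have arg: "1 - x\<^sup>2 / 4 \<in> {3 / 4..1}" if "x \<in> {0..1}" for x :: real
    using power_le_one[of x 2] that by simp
  have I: "((\<lambda>x. x ^ (d - 1)) has_integral 1 / real d) {0..1::real}"
  proof -
    have "((\<lambda>x. x ^ (d - 1)) has_integral (1 ^ d / real d - 0 ^ d / real d)) {0..1::real}"
      using assms
      by (intro fundamental_theorem_of_calculus)
         (auto intro!: derivative_eq_intros simp flip: has_real_derivative_iff_has_vector_derivative)
    then show ?thesis using assms by (simp add: power_0_left)
  qed
  have "0 < 1 / real d * ?m" using assms inc_beta_half_pos[of ?a "3 / 4"] by simp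
  also have "\<dots> = integral {0..1} (\<lambda>x. x ^ (d - 1) * ?m)"
    by (rule integral_unique[OF has_integral_mult_left[OF I], symmetric])
  also have "\<dots> \<le> integral {0..1} (\<lambda>x. x ^ (d - 1) * ?h x)"
  proof (rule integral_le)
    show "(\<lambda>x. x ^ (d - 1) * ?m) integrable_on {0..1}"
      by (intro integrable_continuous_interval continuous_intros)
    have "continuous_on {0..1} ?h"
      by (rule continuous_on_compose2[OF inc_beta_continuous])
         (use arg in \<open>force intro!: continuous_intros\<close>)+
    then show "(\<lambda>x. x ^ (d - 1) * ?h x) integrable_on {0..1}"
      by (intro integrable_continuous_interval continuous_intros)
    fix x :: real assume x: "x \<in> {0..1}"
    then have "?m \<le> ?h x"
      using arg[OF x] by (intro inc_beta_mono) auto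
    then show "x ^ (d - 1) * ?m \<le> x ^ (d - 1) * ?h x"
      using x by (intro mult_left_mono) auto
  qed
  finally show ?thesis using assms by (simp add: alpha_dim_def)
qed

theorem corollary3p1p1:
  fixes d :: nat
  assumes "d \<ge> 1"
  shows "(\<lambda>c::real. J_star c (alpha_dim d)) \<sim>[at_top] (\<lambda>c. inverse (1 + alpha_dim d * c))"
  using J_star_asymp_equiv[OF alpha_dim_pos[OF assms]] .

end
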